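(* Let $\Omega$ be a nonempty simply connected domain in $\mathbb{C}$, and let $\mathcal{S}(\Omega)$ be the set of all $f\in\mathcal{H}ol(\Omega)$ such that $\{\widetilde{T}_N(f): N\ge 0\}$ is dense in $\mathcal{H}ol(\Omega)$. Then either $\mathcal{S}(\Omega)=\emptyset$ or $\mathcal{S}(\Omega)$ is a dense $G_\delta$ set in $\mathcal{H}ol(\Omega)$.
   Context: A domain is an open connected subset of $\mathbb{C}$. $\mathcal{H}ol(\Omega)$ is the space of all holomorphic functions on $\Omega$ with the topology of uniform convergence on compact subsets of $\Omega$. A $G_\delta$ set is a countable intersection of open sets. For each integer $N\ge 0$, $\widetilde{T}_N:\mathcal{H}ol(\Omega)\to\mathcal{H}ol(\Omega)$ is defined by $\widetilde{T}_N(f)(\zeta)=\sum_{n=0}^{N}\frac{f^{(n)}(\zeta)}{n!}(-\zeta)^n$ for $\zeta\in\Omega$. *)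

theory Defs
  imports "HOL-Complex_Analysis.Complex_Analysis" "HOL-Library.FuncSet"
begin

text \<open>
  Elements of Hol(\<Omega>) are functions on \<Omega>, so they are represented by the functions that are
  \<^const>\<open>undefined\<close> outside \<Omega>. This makes equality of representatives the same as equality
  on \<Omega>.
\<close>

definition hol :: "complex set \<Rightarrow> (complex \<Rightarrow> complex) set" where
  "hol \<Omega> = {f \<in> extensional \<Omega>. f holomorphic_on \<Omega>}"

definition hol_nbhd :: "complex set \<Rightarrow> (complex \<Rightarrow> complex) \<Rightarrow> complex set \<Rightarrow> real
    \<Rightarrow> (complex \<Rightarrow> complex) set" where
  "hol_nbhd \<Omega> f K \<epsilon> = {g \<in> hol \<Omega>. \<forall>z\<in>K. dist (g z) (f z) < \<epsilon>}"

text \<open>The topology of uniform convergence on compact subsets; see \<open>limitin_hol_topology\<close>.\<close>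

definition hol_topology :: "complex set \<Rightarrow> (complex \<Rightarrow> complex) topology" where
  "hol_topology \<Omega> = topology (\<lambda>U. U \<subseteq> hol \<Omega> \<and>
     (\<forall>f\<in>U. \<exists>K \<epsilon>. compact K \<and> K \<subseteq> \<Omega> \<and> \<epsilon> > 0 \<and> hol_nbhd \<Omega> f K \<epsilon> \<subseteq> U))"

definition T_tilde :: "complex set \<Rightarrow> nat \<Rightarrow> (complex \<Rightarrow> complex) \<Rightarrow> (complex \<Rightarrow> complex)" where
  "T_tilde \<Omega> N f = (\<lambda>\<zeta>\<in>\<Omega>. \<Sum>n\<le>N. (deriv ^^ n) f \<zeta> / fact n * (- \<zeta>) ^ n)"

definition S_class :: "complex set \<Rightarrow> (complex \<Rightarrow> complex) set" where
  "S_class \<Omega> = {f \<in> hol \<Omega>.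
     hol_topology \<Omega> closure_of range (\<lambda>N. T_tilde \<Omega> N f) = topspace (hol_topology \<Omega>)}"

lemma openin_hol_topology:
  "openin (hol_topology \<Omega>) U \<longleftrightarrow> U \<subseteq> hol \<Omega> \<and>
     (\<forall>f\<in>U. \<exists>K \<epsilon>. compact K \<and> K \<subseteq> \<Omega> \<and> \<epsilon> > 0 \<and> hol_nbhd \<Omega> f K \<epsilon> \<subseteq> U)"
proof -
  let ?P = "\<lambda>U. U \<subseteq> hol \<Omega> \<and>
     (\<forall>f\<in>U. \<exists>K \<epsilon>. compact K \<and> K \<subseteq> \<Omega> \<and> \<epsilon> > 0 \<and> hol_nbhd \<Omega> f K \<epsilon> \<subseteq> U)"
  have "istopology ?P"
    unfolding istopology_def
  proof (intro conjI allI impI)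
    fix S T assume S: "?P S" and T: "?P T"
    show "S \<inter> T \<subseteq> hol \<Omega>" using S by blast
    show "\<forall>f\<in>S \<inter> T. \<exists>K \<epsilon>. compact K \<and> K \<subseteq> \<Omega> \<and> \<epsilon> > 0 \<and> hol_nbhd \<Omega> f K \<epsilon> \<subseteq> S \<inter> T"
    proof
      fix f assume f: "f \<in> S \<inter> T"
      obtain K e where 1: "compact K" "K \<subseteq> \<Omega>" "e > 0" "hol_nbhd \<Omega> f K e \<subseteq> S"
        using S f by blast
      obtain L d where 2: "compact L" "L \<subseteq> \<Omega>" "d > 0" "hol_nbhd \<Omega> f L d \<subseteq> T"
        using T f by blast
      have "hol_nbhd \<Omega> f (K \<union> L) (min e d) \<subseteq> hol_nbhd \<Omega> f K e \<inter> hol_nbhd \<Omega> f L d"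
        by (auto simp: hol_nbhd_def)
      then have "compact (K \<union> L) \<and> K \<union> L \<subseteq> \<Omega> \<and> min e d > 0 \<and>
          hol_nbhd \<Omega> f (K \<union> L) (min e d) \<subseteq> S \<inter> T"
        using 1 2 by (auto simp: compact_Un)
      then show "\<exists>K \<epsilon>. compact K \<and> K \<subseteq> \<Omega> \<and> \<epsilon> > 0 \<and> hol_nbhd \<Omega> f K \<epsilon> \<subseteq> S \<inter> T" by blast
    qed
  next
    fix \<K> assume K: "\<forall>U\<in>\<K>. ?P U"
    show "\<Union>\<K> \<subseteq> hol \<Omega>" using K by blast
    show "\<forall>f\<in>\<Union>\<K>. \<exists>K \<epsilon>. compact K \<and> K \<subseteq> \<Omega> \<and> \<epsilon> > 0 \<and> hol_nbhd \<Omega> f K \<epsilon> \<subseteq> \<Union>\<K>"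
    proof
      fix f assume "f \<in> \<Union>\<K>"
      then obtain U where U: "U \<in> \<K>" "f \<in> U" by (elim UnionE)
      have "?P U" using K U(1) by (rule bspec)
      then have "\<exists>K \<epsilon>. compact K \<and> K \<subseteq> \<Omega> \<and> \<epsilon> > 0 \<and> hol_nbhd \<Omega> f K \<epsilon> \<subseteq> U"
        using U(2) by simp
      moreover have "U \<subseteq> \<Union>\<K>" using U by blast
      ultimately show "\<exists>K \<epsilon>. compact K \<and> K \<subseteq> \<Omega> \<and> \<epsilon> > 0 \<and> hol_nbhd \<Omega> f K \<epsilon> \<subseteq> \<Union>\<K>"
        by (elim exE conjE) (intro exI conjI, assumption+, rule subset_trans)
    qed
  qed
  then show ?thesis
    unfolding hol_topology_def by (simp add: topology_inverse')
qed

lemma topspace_hol_topology [simp]: "topspace (hol_topology \<Omega>) = hol \<Omega>"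
proof -
  have "openin (hol_topology \<Omega>) (hol \<Omega>)"
    unfolding openin_hol_topology
  proof (intro conjI ballI)
    fix f
    have "compact {} \<and> {} \<subseteq> \<Omega> \<and> (1::real) > 0 \<and> hol_nbhd \<Omega> f {} 1 \<subseteq> hol \<Omega>"
      by (simp add: hol_nbhd_def)
    then show "\<exists>K \<epsilon>. compact K \<and> K \<subseteq> \<Omega> \<and> \<epsilon> > 0 \<and> hol_nbhd \<Omega> f K \<epsilon> \<subseteq> hol \<Omega>" by blast
  qed simp
  then show ?thesis
    using openin_subset[of "hol_topology \<Omega>" "hol \<Omega>"]
      openin_topspace[of "hol_topology \<Omega>", unfolded openin_hol_topology] by blast
qed

lemma openin_hol_nbhd:
  assumes "compact K" "K \<subseteq> \<Omega>" "f \<in> hol \<Omega>"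
  shows "openin (hol_topology \<Omega>) (hol_nbhd \<Omega> f K \<epsilon>)"
  unfolding openin_hol_topology
proof (intro conjI ballI)
  show "hol_nbhd \<Omega> f K \<epsilon> \<subseteq> hol \<Omega>" by (auto simp: hol_nbhd_def)
  fix g assume g: "g \<in> hol_nbhd \<Omega> f K \<epsilon>"
  have "\<exists>\<delta>>0. hol_nbhd \<Omega> g K \<delta> \<subseteq> hol_nbhd \<Omega> f K \<epsilon>"
  proof (cases "K = {}")
    case True
    then show ?thesis using g by (intro exI[of _ "1::real"]) (simp add: hol_nbhd_def)
  next
    case False
    have "continuous_on K g" "continuous_on K f"
      using g assms holomorphic_on_imp_continuous_on continuous_on_subset
      unfolding hol_nbhd_def hol_def by blast+
    then have "continuous_on K (\<lambda>z. dist (g z) (f z))"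
      by (intro continuous_intros)
    then obtain w where w: "w \<in> K" "\<forall>z\<in>K. dist (g z) (f z) \<le> dist (g w) (f w)"
      using continuous_attains_sup[OF assms(1) False] by blast
    have lt: "dist (g w) (f w) < \<epsilon>" using g w by (auto simp: hol_nbhd_def)
    have "hol_nbhd \<Omega> g K (\<epsilon> - dist (g w) (f w)) \<subseteq> hol_nbhd \<Omega> f K \<epsilon>"
    proof
      fix h assume h: "h \<in> hol_nbhd \<Omega> g K (\<epsilon> - dist (g w) (f w))"
      have "dist (h z) (f z) < \<epsilon>" if "z \<in> K" for z
      proof -
        have "dist (h z) (g z) < \<epsilon> - dist (g w) (f w)" "dist (g z) (f z) \<le> dist (g w) (f w)"
          using h w that by (simp_all add: hol_nbhd_def)
        then show ?thesis using dist_triangle[of "h z" "f z" "g z"] by linarith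
      qed
      then show "h \<in> hol_nbhd \<Omega> f K \<epsilon>" using h by (auto simp: hol_nbhd_def)
    qed
    then show ?thesis using lt by (intro exI[of _ "\<epsilon> - dist (g w) (f w)"]) auto
  qed
  then show "\<exists>L \<delta>. compact L \<and> L \<subseteq> \<Omega> \<and> \<delta> > 0 \<and> hol_nbhd \<Omega> g L \<delta> \<subseteq> hol_nbhd \<Omega> f K \<epsilon>"
    using assms by blast
qed

lemma limitin_hol_topology:
  assumes "f \<in> hol \<Omega>" "\<forall>\<^sub>F n in F. u n \<in> hol \<Omega>"
  shows "limitin (hol_topology \<Omega>) u f F \<longleftrightarrow>
    (\<forall>K. compact K \<longrightarrow> K \<subseteq> \<Omega> \<longrightarrow> uniform_limit K u f F)"
proof
  assume lim: "limitin (hol_topology \<Omega>) u f F"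
  show "\<forall>K. compact K \<longrightarrow> K \<subseteq> \<Omega> \<longrightarrow> uniform_limit K u f F"
    unfolding uniform_limit_iff
  proof (intro allI impI)
    fix K and e :: real assume K: "compact K" "K \<subseteq> \<Omega>" and "e > 0"
    then have "f \<in> hol_nbhd \<Omega> f K e" using assms by (auto simp: hol_nbhd_def)
    then have "\<forall>\<^sub>F n in F. u n \<in> hol_nbhd \<Omega> f K e"
      using lim openin_hol_nbhd[OF K assms(1)] by (auto simp: limitin_def)
    then show "\<forall>\<^sub>F n in F. \<forall>x\<in>K. dist (u n x) (f x) < e"
      by eventually_elim (auto simp: hol_nbhd_def)
  qed
next
  assume *: "\<forall>K. compact K \<longrightarrow> K \<subseteq> \<Omega> \<longrightarrow> uniform_limit K u f F"
  show "limitin (hol_topology \<Omega>) u f F"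
    unfolding limitin_def
  proof (intro conjI allI impI)
    show "f \<in> topspace (hol_topology \<Omega>)" using assms by simp
    fix U assume "openin (hol_topology \<Omega>) U \<and> f \<in> U"
    then obtain K e where K: "compact K" "K \<subseteq> \<Omega>" "e > 0" "hol_nbhd \<Omega> f K e \<subseteq> U"
      unfolding openin_hol_topology by blast
    then have "\<forall>\<^sub>F n in F. \<forall>x\<in>K. dist (u n x) (f x) < e"
      using * by (auto simp: uniform_limit_iff)
    with assms(2) show "\<forall>\<^sub>F n in F. u n \<in> U"
      by eventually_elim (use K in \<open>auto simp: hol_nbhd_def\<close>)
  qed
qed

lemma T_tilde_in_hol:
  assumes "open \<Omega>" "f \<in> hol \<Omega>"
  shows "T_tilde \<Omega> N f \<in> hol \<Omega>"
proof -
  have "(\<lambda>\<zeta>. \<Sum>n\<le>N. (deriv ^^ n) f \<zeta> / fact n * (- \<zeta>) ^ n) holomorphic_on \<Omega>"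
    using assms by (intro holomorphic_intros) (auto simp: hol_def intro: holomorphic_higher_deriv)
  then have "T_tilde \<Omega> N f holomorphic_on \<Omega>"
    unfolding T_tilde_def by (rule holomorphic_transform) auto
  then show ?thesis by (simp add: hol_def T_tilde_def)
qed

end

theory Submission
  imports Defs
begin

text \<open>
  If \<open>p\<close> is a polynomial and \<open>N \<ge> degree p\<close>, then by Taylor's formula \<open>T_tilde \<Omega> N p\<close> is the
  constant \<open>p 0\<close>. Hence adding \<open>p\<close> to \<open>f \<in> S_class \<Omega>\<close> shifts a tail of the sequence
  \<open>T_tilde \<Omega> N f\<close> by a constant; since the space of holomorphic functions has no isolated points,
  that tail is still dense, so \<open>f + p \<in> S_class \<Omega>\<close>. By Runge's theorem the polynomials are dense,
  hence so is \<open>S_class \<Omega>\<close>. For the countable intersection, note that the existence of one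
  \<open>f0 \<in> S_class \<Omega>\<close> makes the space separable, with dense sequence \<open>T_tilde \<Omega> k f0\<close>.

  Runge's theorem comes from the Riemann map \<open>g\<close>: Cauchy's formula on the image of a circle
  writes \<open>f\<close> as an integral of simple fractions whose poles lie off the compact set
  \<open>g ` cball 0 r\<close>. The complement of this set is connected, so the poles can be pushed to infinity.
\<close>

section \<open>Polynomial approximation\<close>

text \<open>Stated by pointwise bounds rather than by a supremum norm, so that nothing has to be
  shown bounded first and the empty set causes no trouble.\<close>

definition poly_approximable :: "complex set \<Rightarrow> (complex \<Rightarrow> complex) \<Rightarrow> bool" where
  "poly_approximable K f \<longleftrightarrow> (\<forall>e>0. \<exists>p. \<forall>z\<in>K. norm (f z - poly p z) < e)"

lemma poly_approximable_poly: "poly_approximable K (poly p)"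
  unfolding poly_approximable_def by (intro allI impI exI[of _ p]) simp

lemma poly_approximable_const: "poly_approximable K (\<lambda>z. c)"
  unfolding poly_approximable_def by (intro allI impI exI[of _ "[:c:]"]) simp

lemma poly_approximable_ident: "poly_approximable K (\<lambda>z. z)"
  unfolding poly_approximable_def by (intro allI impI exI[of _ "[:0, 1:]"]) simp

lemma poly_approximable_cong:
  assumes "poly_approximable K f" "\<And>z. z \<in> K \<Longrightarrow> f z = g z"
  shows "poly_approximable K g"
  using assms unfolding poly_approximable_def by metis

lemma poly_approximable_subset:
  assumes "poly_approximable K f" "L \<subseteq> K"
  shows "poly_approximable L f"
  using assms unfolding poly_approximable_def by (meson subsetD)

lemma poly_approximable_uniform_closure:
  assumes "\<And>e. e > 0 \<Longrightarrow> \<exists>g. poly_approximable K g \<and> (\<forall>z\<in>K. norm (f z - g z) < e)"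
  shows "poly_approximable K f"
  unfolding poly_approximable_def
proof (intro allI impI)
  fix e :: real assume "e > 0"
  then have e2: "e / 2 > 0" by simp
  then obtain g where g: "poly_approximable K g" "\<forall>z\<in>K. norm (f z - g z) < e / 2"
    using assms by blast
  obtain p where p: "\<forall>z\<in>K. norm (g z - poly p z) < e / 2"
    using g(1) e2 unfolding poly_approximable_def by blast
  have "norm (f z - poly p z) < e" if "z \<in> K" for z
    using norm_diff_triangle_less[of "f z" "g z" "e / 2" "poly p z" "e / 2"] g(2) p that by simp
  then show "\<exists>p. \<forall>z\<in>K. norm (f z - poly p z) < e" by blast
qed

lemma poly_approximable_add:
  assumes "poly_approximable K f" "poly_approximable K g"
  shows "poly_approximable K (\<lambda>z. f z + g z)"
  unfolding poly_approximable_def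
proof (intro allI impI)
  fix e :: real assume "e > 0"
  then have e2: "e / 2 > 0" by simp
  obtain p q where pq: "\<forall>z\<in>K. norm (f z - poly p z) < e / 2" "\<forall>z\<in>K. norm (g z - poly q z) < e / 2"
    using assms e2 unfolding poly_approximable_def by meson
  have "norm (f z + g z - poly (p + q) z) < e" if "z \<in> K" for z
  proof -
    have "f z + g z - poly (p + q) z = (f z - poly p z) + (g z - poly q z)" by simp
    then show ?thesis
      using norm_add_less[of "f z - poly p z" "e / 2" "g z - poly q z" "e / 2"] pq that
      by (simp add: algebra_simps)
  qed
  then show "\<exists>p. \<forall>z\<in>K. norm (f z + g z - poly p z) < e" by blast
qed

text \<open>A polynomial within distance 1 of \<open>f\<close> is bounded on the compact set. The
  bound is needed to control products.\<close>

lemma poly_approximable_imp_bounded: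
  assumes "poly_approximable K f" "compact K"
  obtains B where "B > 0" "\<And>z. z \<in> K \<Longrightarrow> norm (f z) \<le> B"
proof -
  obtain p where p: "\<forall>z\<in>K. norm (f z - poly p z) < 1"
    using assms(1) unfolding poly_approximable_def by (meson zero_less_one)
  have "compact (poly p ` K)"
    by (intro compact_continuous_image assms continuous_intros)
  then obtain B where B: "B > 0" "\<And>z. z \<in> K \<Longrightarrow> norm (poly p z) \<le> B"
    using bounded_pos[of "poly p ` K"] compact_imp_bounded by blast
  show thesis
  proof (rule that[of "B + 1"])
    show "norm (f z) \<le> B + 1" if "z \<in> K" for z
      using norm_triangle_ineq2[of "f z" "poly p z"] B(2)[OF that] p that by fastforce
  qed (use B in simp)
qed

lemma poly_approximable_mult_poly:
  assumes "poly_approximable K f" "compact K"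
  shows "poly_approximable K (\<lambda>z. f z * poly q z)"
  unfolding poly_approximable_def
proof (intro allI impI)
  fix e :: real assume "e > 0"
  obtain B where B: "B > 0" "\<And>z. z \<in> K \<Longrightarrow> norm (poly q z) \<le> B"
    using poly_approximable_imp_bounded[OF poly_approximable_poly assms(2)] by blast
  obtain p where p: "\<forall>z\<in>K. norm (f z - poly p z) < e / B"
    using assms(1) \<open>e > 0\<close> B(1) unfolding poly_approximable_def by (meson divide_pos_pos)
  have "norm (f z * poly q z - poly (p * q) z) < e" if "z \<in> K" for z
  proof -
    have "norm (f z * poly q z - poly (p * q) z) = norm (f z - poly p z) * norm (poly q z)"
      by (simp add: left_diff_distrib flip: norm_mult)
    also have "\<dots> \<le> norm (f z - poly p z) * B"
      using B(2)[OF that] by (intro mult_left_mono) auto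
    also have "\<dots> < e"
      using p that B(1) by (simp add: field_simps)
    finally show ?thesis .
  qed
  then show "\<exists>p. \<forall>z\<in>K. norm (f z * poly q z - poly p z) < e" by blast
qed

text \<open>One factor at a time: \<open>g\<close> is replaced by a polynomial \<open>q\<close> with
  error \<open>e / B\<close>, where \<open>B\<close> bounds \<open>f\<close>, and the product of
  \<open>f\<close> with \<open>q\<close> is already approximable.\<close>

lemma poly_approximable_mult:
  assumes "poly_approximable K f" "poly_approximable K g" "compact K"
  shows "poly_approximable K (\<lambda>z. f z * g z)"
proof (rule poly_approximable_uniform_closure)
  fix e :: real assume "e > 0"
  obtain B where B: "B > 0" "\<And>z. z \<in> K \<Longrightarrow> norm (f z) \<le> B"
    using poly_approximable_imp_bounded[OF assms(1,3)] by blast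
  obtain q where q: "\<forall>z\<in>K. norm (g z - poly q z) < e / B"
    using assms(2) \<open>e > 0\<close> B(1) unfolding poly_approximable_def by (meson divide_pos_pos)
  have "norm (f z * g z - f z * poly q z) < e" if "z \<in> K" for z
  proof -
    have "norm (f z * g z - f z * poly q z) = norm (f z) * norm (g z - poly q z)"
      by (simp add: right_diff_distrib flip: norm_mult)
    also have "\<dots> \<le> B * norm (g z - poly q z)"
      using B(2)[OF that] by (intro mult_right_mono) auto
    also have "\<dots> < e"
      using q that B(1) by (simp add: field_simps)
    finally show ?thesis .
  qed
  with poly_approximable_mult_poly[OF assms(1,3)]
  show "\<exists>h. poly_approximable K h \<and> (\<forall>z\<in>K. norm (f z * g z - h z) < e)" by blast
qed

section \<open>Geometric series, simple poles and integrals\<close>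

text \<open>The partial sums of the geometric series in \<open>u\<close> are approximable and
  converge uniformly: the remainder \<open>u z ^ n / (1 - u z)\<close> has norm at most
  \<open>2 * (1 / 2) ^ n\<close>.\<close>

lemma poly_approximable_geometric:
  assumes u: "poly_approximable K u" and K: "compact K"
    and le: "\<And>z. z \<in> K \<Longrightarrow> norm (u z) \<le> 1 / 2"
  shows "poly_approximable K (\<lambda>z. 1 / (1 - u z))"
proof (rule poly_approximable_uniform_closure)
  fix e :: real assume "e > 0"
  have pow: "poly_approximable K (\<lambda>z. u z ^ n)" for n
    by (induction n) (simp_all add: poly_approximable_const poly_approximable_mult u K)
  have sum: "poly_approximable K (\<lambda>z. \<Sum>k<n. u z ^ k)" for n
    by (induction n) (simp_all add: poly_approximable_const poly_approximable_add pow)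
  obtain n where n: "(1 / 2) ^ n < e / 2"
    using real_arch_pow_inv[of "e / 2" "1 / 2"] \<open>e > 0\<close> by auto
  have "norm (1 / (1 - u z) - (\<Sum>k<n. u z ^ k)) < e" if "z \<in> K" for z
  proof -
    have ge: "norm (1 - u z) \<ge> 1 / 2"
      using norm_triangle_ineq2[of 1 "u z"] le[OF that] by simp
    then have ne: "u z \<noteq> 1" by auto
    have "1 / (1 - u z) - (\<Sum>k<n. u z ^ k) = u z ^ n / (1 - u z)"
      using ne by (simp add: sum_gp_strict field_simps)
    then have "norm (1 / (1 - u z) - (\<Sum>k<n. u z ^ k)) = norm (u z) ^ n / norm (1 - u z)"
      by (simp add: norm_divide norm_power)
    also have "\<dots> \<le> (1 / 2) ^ n / (1 / 2)"
      using ge le[OF that] by (intro frac_le power_mono) auto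
    also have "\<dots> < e" using n by simp
    finally show ?thesis .
  qed
  with sum show "\<exists>g. poly_approximable K g \<and> (\<forall>z\<in>K. norm (1 / (1 - u z) - g z) < e)" by blast
qed

text \<open>With \<open>u z = (w - w0) / (z - w0)\<close> one has
  \<open>1 / (z - w) = 1 / (z - w0) * (1 / (1 - u z))\<close>, and \<open>le\<close> says that
  \<open>u\<close> has norm at most 1/2 on \<open>K\<close>.\<close>

lemma poly_approximable_move_pole:
  assumes K: "compact K" and w0: "poly_approximable K (\<lambda>z. 1 / (z - w0))" "w0 \<notin> K"
    and le: "\<And>z. z \<in> K \<Longrightarrow> 2 * norm (w - w0) \<le> norm (z - w0)"
  shows "poly_approximable K (\<lambda>z. 1 / (z - w))"
proof -
  define u where "u = (\<lambda>z. (w - w0) * (1 / (z - w0)))"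
  have u: "poly_approximable K u"
    unfolding u_def by (intro poly_approximable_mult poly_approximable_const w0 K)
  have "norm (u z) \<le> 1 / 2" if "z \<in> K" for z
  proof -
    have "z \<noteq> w0" using that w0 by auto
    then show ?thesis
      using le[OF that] by (simp add: u_def norm_mult norm_divide field_simps)
  qed
  then have "poly_approximable K (\<lambda>z. 1 / (z - w0) * (1 / (1 - u z)))"
    by (intro poly_approximable_mult poly_approximable_geometric u w0 K)
  then show ?thesis
  proof (rule poly_approximable_cong)
    fix z assume "z \<in> K"
    then have ne: "z - w0 \<noteq> 0" using w0 by auto
    then have "1 - u z = (z - w) / (z - w0)"
      by (simp add: u_def field_simps)
    then show "1 / (z - w0) * (1 / (1 - u z)) = 1 / (z - w)"
      using ne by simp
  qed
qed

text \<open>Whether \<open>1 / (z - a)\<close> is approximable is a locally constant property of the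
  pole \<open>a\<close> in \<open>- K\<close>. Since \<open>- K\<close> is connected, it suffices to
  find one good pole, and one far away from \<open>K\<close> is good.\<close>

lemma poly_approximable_pole:
  assumes K: "compact K" and con: "connected (- K)" and w: "w \<notin> K"
  shows "poly_approximable K (\<lambda>z. 1 / (z - w))"
proof -
  obtain R where R: "R > 0" "\<And>z. z \<in> K \<Longrightarrow> norm z \<le> R"
    using compact_imp_bounded[OF K] bounded_pos by blast
  \<comment> \<open>Norm \<open>2 * R\<close> puts \<open>v\<close> outside \<open>K\<close> and
    makes \<open>z / v\<close> at most 1/2 in norm on \<open>K\<close>, so that
    \<open>1 / (z - v)\<close> is a geometric series in \<open>z / v\<close>.\<close>
  define v where "v = complex_of_real (2 * R)"
  have nv: "norm v = 2 * R" using R by (simp add: v_def norm_mult)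
  have vK: "v \<notin> K" using R(2)[of v] nv R(1) by auto
  have "poly_approximable K (\<lambda>z. (- 1 / v) * (1 / (1 - (1 / v) * z)))"
  proof (intro poly_approximable_mult poly_approximable_const poly_approximable_geometric
      poly_approximable_ident K)
    show "norm (1 / v * z) \<le> 1 / 2" if "z \<in> K" for z
      using R(2)[OF that] R(1) nv by (simp add: norm_mult norm_divide field_simps)
  qed
  then have far: "poly_approximable K (\<lambda>z. 1 / (z - v))"
  proof (rule poly_approximable_cong)
    fix z assume "z \<in> K"
    then have ne: "z \<noteq> v" "v \<noteq> 0" using vK nv R(1) by auto
    then show "(- 1 / v) * (1 / (1 - (1 / v) * z)) = 1 / (z - v)"
      by (simp add: divide_simps)
  qed
  have "poly_approximable K (\<lambda>z. 1 / (z - v)) = poly_approximable K (\<lambda>z. 1 / (z - w))"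
  proof (rule connected_local_const[OF con])
    show "\<forall>a\<in>- K. \<forall>\<^sub>F b in at a within - K.
        poly_approximable K (\<lambda>z. 1 / (z - a)) = poly_approximable K (\<lambda>z. 1 / (z - b))"
    proof
      fix a assume a: "a \<in> - K"
      have "open (- K)" using K compact_imp_closed by blast
      then obtain d where d: "d > 0" "ball a d \<subseteq> - K" using a open_contains_ball by blast
      show "\<forall>\<^sub>F b in at a within - K.
        poly_approximable K (\<lambda>z. 1 / (z - a)) = poly_approximable K (\<lambda>z. 1 / (z - b))"
        unfolding eventually_at
      \<comment> \<open>If \<open>b\<close> is within \<open>d / 3\<close> of \<open>a\<close>,
        points of \<open>K\<close> have distance at least \<open>d\<close> from \<open>a\<close> and
        more than \<open>2 * d / 3\<close> from \<open>b\<close>. So the pole can be moved from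
        \<open>a\<close> to \<open>b\<close> and back, which gives the equality of truth
        values.\<close>
      proof (intro exI[of _ "d / 3"] conjI ballI impI)
        fix b assume b: "b \<in> - K" "b \<noteq> a \<and> dist b a < d / 3"
        have far_a: "norm (z - a) \<ge> d" if "z \<in> K" for z
          using d(2) that by (force simp: dist_norm norm_minus_commute not_less[symmetric])
        have "2 * norm (b - a) \<le> norm (z - a) \<and> 2 * norm (a - b) \<le> norm (z - b)"
          if "z \<in> K" for z
          using far_a[OF that] d(1) b(2) norm_triangle_ineq[of "z - b" "b - a"] norm_minus_commute[of a b]
          by (simp add: dist_norm)
        then have ge: "\<And>z. z \<in> K \<Longrightarrow> 2 * norm (b - a) \<le> norm (z - a)"
          "\<And>z. z \<in> K \<Longrightarrow> 2 * norm (a - b) \<le> norm (z - b)"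
          by blast+
        show "poly_approximable K (\<lambda>z. 1 / (z - a)) = poly_approximable K (\<lambda>z. 1 / (z - b))"
          using poly_approximable_move_pole[OF K _ _ ge(1)] poly_approximable_move_pole[OF K _ _ ge(2)]
            a b(1) by blast
      qed (use d in auto)
    qed
  qed (use vK w in auto)
  with far show ?thesis by simp
qed

text \<open>Bolzano's bisection principle takes the place of Riemann sums: an error bound
  proportional to the length of the interval adds up over adjacent intervals, and on short intervals
  it follows from uniform continuity.\<close>

lemma poly_approximable_integral:
  assumes K: "compact K" and cont: "continuous_on ({0..1} \<times> K) (\<lambda>(t, z). F t z)"
    and appr: "\<And>t. t \<in> {0..1} \<Longrightarrow> poly_approximable K (F t)"
    and int: "\<And>z. z \<in> K \<Longrightarrow> ((\<lambda>t::real. F t z) has_integral f z) {0..1}"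
  shows "poly_approximable K f"
  unfolding poly_approximable_def
proof (intro allI impI)
  fix e' :: real assume "e' > 0"
  \<comment> \<open>Bisection gives the bound \<open>\<le> e\<close>, while a strict bound by
    \<open>e'\<close> is wanted.\<close>
  define e where "e = e' / 2"
  have e: "e > 0" "e < e'" using \<open>e' > 0\<close> by (simp_all add: e_def)
  \<comment> \<open>The two premises confine the claim to subintervals of [0, 1], because the
    bisection principle speaks of all real \<open>a\<close> and \<open>b\<close>.\<close>
  define P where "P = (\<lambda>a b. 0 \<le> a \<longrightarrow> b \<le> 1 \<longrightarrow>
    (\<exists>p. \<forall>z\<in>K. norm (integral {a..b} (\<lambda>t. F t z) - poly p z) \<le> e * (b - a)))"
  have contz: "continuous_on {a..b} (\<lambda>t. F t z)" if "z \<in> K" "0 \<le> a" "b \<le> 1" for z a b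
    using that by (intro continuous_on_compose2[OF cont, of _ "\<lambda>t. (t, z)", simplified])
      (auto intro!: continuous_intros)
  have "P 0 1"
  proof (rule Bolzano)
    show "(0::real) \<le> 1" by simp
  next
    fix a b c assume ab: "P a b" "P b c" "a \<le> b" "b \<le> c"
    show "P a c"
      unfolding P_def
    proof (intro impI)
      assume ac: "0 \<le> a" "c \<le> 1"
      obtain p q where pq: "\<forall>z\<in>K. norm (integral {a..b} (\<lambda>t. F t z) - poly p z) \<le> e * (b - a)"
        "\<forall>z\<in>K. norm (integral {b..c} (\<lambda>t. F t z) - poly q z) \<le> e * (c - b)"
        using ab ac unfolding P_def by fastforce
      have "norm (integral {a..c} (\<lambda>t. F t z) - poly (p + q) z) \<le> e * (c - a)" if "z \<in> K" for z
      proof -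
        have "integral {a..b} (\<lambda>t. F t z) + integral {b..c} (\<lambda>t. F t z) = integral {a..c} (\<lambda>t. F t z)"
          using ab ac contz[OF that] by (intro Henstock_Kurzweil_Integration.integral_combine
              integrable_continuous_interval) auto
        then have "integral {a..c} (\<lambda>t. F t z) - poly (p + q) z =
          (integral {a..b} (\<lambda>t. F t z) - poly p z) + (integral {b..c} (\<lambda>t. F t z) - poly q z)"
          by simp
        then have "norm (integral {a..c} (\<lambda>t. F t z) - poly (p + q) z) \<le> e * (b - a) + e * (c - b)"
          using pq that by (metis norm_triangle_mono)
        then show ?thesis by (simp add: algebra_simps)
      qed
      then show "\<exists>p. \<forall>z\<in>K. norm (integral {a..c} (\<lambda>t. F t z) - poly p z) \<le> e * (c - a)" by blast
    qed
  next
    fix x :: real assume x: "0 \<le> x" "x \<le> 1"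
    have "uniformly_continuous_on ({0..1} \<times> K) (\<lambda>(t, z). F t z)"
      by (intro compact_uniformly_continuous cont compact_Times K compact_Icc)
    then obtain d where d: "d > 0" "\<And>y y'. y \<in> {0..1} \<times> K \<Longrightarrow> y' \<in> {0..1} \<times> K \<Longrightarrow>
        dist y' y < d \<Longrightarrow> dist ((\<lambda>(t, z). F t z) y') ((\<lambda>(t, z). F t z) y) < e / 2"
      unfolding uniformly_continuous_on_def using e(1) by (metis half_gt_zero)
    obtain p where p: "\<forall>z\<in>K. norm (F x z - poly p z) < e / 2"
      using appr[of x] x e(1) unfolding poly_approximable_def by (metis half_gt_zero atLeastAtMost_iff)
    show "\<exists>d>0. \<forall>a b. a \<le> x \<and> x \<le> b \<and> b - a < d \<longrightarrow> P a b"
    proof (intro exI[of _ d] conjI allI impI)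
      fix a b assume ab: "a \<le> x \<and> x \<le> b \<and> b - a < d"
      show "P a b"
        unfolding P_def
      \<comment> \<open>On a short interval around \<open>x\<close> the integrand is within
        \<open>e / 2\<close> of \<open>F x\<close>, which is within \<open>e / 2\<close> of
        \<open>p\<close>; hence the integral is close to \<open>b - a\<close> times
        \<open>p\<close>.\<close>
      proof (intro impI exI[of _ "smult (of_real (b - a)) p"] ballI)
        fix z assume ab': "0 \<le> a" "b \<le> 1" and z: "z \<in> K"
        have bound: "norm (F t z - poly p z) \<le> e" if "t \<in> {a..b}" for t
        proof -
          have "dist (F t z) (F x z) < e / 2"
            using d(2)[of "(x, z)" "(t, z)"] that ab ab' z x
            by (auto simp: dist_Pair_Pair dist_real_def)
          moreover have "dist (F x z) (poly p z) < e / 2"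
            using p z by (simp add: dist_norm)
          ultimately show ?thesis
            using dist_triangle[of "F t z" "poly p z" "F x z"] by (simp add: dist_norm)
        qed
        have "integral {a..b} (\<lambda>t. F t z - poly p z) =
          integral {a..b} (\<lambda>t. F t z) - poly (smult (of_real (b - a)) p) z"
          using ab contz[OF z ab'] 
          by (subst Henstock_Kurzweil_Integration.integral_diff)
            (auto intro!: integrable_continuous_interval simp: scaleR_conv_of_real)
        moreover have "norm (integral {a..b} (\<lambda>t. F t z - poly p z)) \<le> e * (b - a)"
          using ab bound contz[OF z ab'] by (intro integral_bound) (auto intro!: continuous_intros)
        ultimately show "norm (integral {a..b} (\<lambda>t. F t z)
            - poly (smult (of_real (b - a)) p) z) \<le> e * (b - a)" by simp
      qed
    qed (rule d(1))
  qed
  then obtain p where p: "\<forall>z\<in>K. norm (integral {0..1} (\<lambda>t. F t z) - poly p z) \<le> e"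
    unfolding P_def by auto
  show "\<exists>p. \<forall>z\<in>K. norm (f z - poly p z) < e'"
    using p e(2) integral_unique[OF int] by (intro exI[of _ p]) force
qed

section \<open>Cauchy's formula on the image of a circle, and Runge's theorem\<close>

text \<open>No winding number of the image curve is computed. The integrand is
  \<open>\<phi> u / (u - a)\<close>, where \<open>\<phi>\<close> has a removable singularity at
  \<open>a\<close>, so that Cauchy's formula for the circle applies to
  \<open>\<phi>\<close>.\<close>

lemma Cauchy_integral_image_circle:
  assumes g: "g holomorphic_on ball 0 1" "inj_on g (ball 0 1)"
    and f: "f holomorphic_on g ` ball 0 1" and a: "norm a < r" and r: "r < 1"
  shows "((\<lambda>u. f (g u) * deriv g u / (g u - g a)) has_contour_integral
    2 * of_real pi * \<i> * f (g a)) (circlepath 0 r)"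
proof -
  let ?D = "ball (0::complex) 1"
  \<comment> \<open>The denominator is the difference quotient of \<open>g\<close>. It tends to
    \<open>deriv g a\<close>, which is nonzero as \<open>g\<close> is injective, so the factor
    \<open>deriv g u\<close> cancels in the limit and leaves \<open>f (g a)\<close>.\<close>
  define \<phi> where "\<phi> = (\<lambda>u. if u = a then f (g a)
    else f (g u) * deriv g u / ((g u - g a) / (u - a)))"
  have aD: "a \<in> ?D" using a r by simp
  have ne: "g u \<noteq> g a" if "u \<in> ?D" "u \<noteq> a" for u
    using g(2) that aD by (auto dest: inj_onD)
  have fg: "(\<lambda>u. f (g u)) holomorphic_on ?D"
    using holomorphic_on_compose[OF g(1) f] by (simp add: o_def)
  have dg: "deriv g holomorphic_on ?D"
    by (intro holomorphic_deriv g open_ball)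
  have dga: "deriv g a \<noteq> 0"
    using holomorphic_injective_imp_regular[OF g(1) open_ball g(2) aD] .
  have "(\<lambda>u. f (g u) * deriv g u / ((g u - g a) / (u - a))) holomorphic_on ?D - {a}"
    using ne by (intro holomorphic_intros holomorphic_on_subset[OF fg] holomorphic_on_subset[OF dg]
      holomorphic_on_subset[OF g(1)]) auto
  then have hol: "\<phi> holomorphic_on ?D - {a}"
    by (rule holomorphic_transform) (auto simp: \<phi>_def)
  have "continuous_on ?D \<phi>"
    unfolding continuous_on_eq_continuous_at[OF open_ball]
  proof
    fix u assume u: "u \<in> ?D"
    show "isCont \<phi> u"
    proof (cases "u = a")
      case False
      have "open (?D - {a})" by (intro open_Diff) auto
      then show ?thesis
        using hol u False continuous_on_eq_continuous_at holomorphic_on_imp_continuous_on by blast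
    next
      case True
      have "(g has_field_derivative deriv g a) (at a)"
        using holomorphic_derivI[OF g(1) open_ball aD] .
      then have "((\<lambda>u. (g u - g a) / (u - a)) \<longlongrightarrow> deriv g a) (at a)"
        by (simp add: has_field_derivative_iff)
      moreover have "((\<lambda>u. f (g u)) \<longlongrightarrow> f (g a)) (at a)" "(deriv g \<longlongrightarrow> deriv g a) (at a)"
        using aD holomorphic_on_imp_continuous_on[OF fg] holomorphic_on_imp_continuous_on[OF dg]
        by (auto simp: continuous_on_eq_continuous_at isCont_def)
      ultimately have "((\<lambda>u. f (g u) * deriv g u / ((g u - g a) / (u - a))) \<longlongrightarrow>
          f (g a) * deriv g a / deriv g a) (at a)"
        using dga by (intro tendsto_intros)
      then have "((\<lambda>u. f (g u) * deriv g u / ((g u - g a) / (u - a))) \<longlongrightarrow> \<phi> a) (at a)"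
        using dga by (simp add: \<phi>_def)
      then have "(\<phi> \<longlongrightarrow> \<phi> a) (at a)"
        by (rule Lim_transform_eventually) (auto simp: \<phi>_def eventually_at_filter)
      then show ?thesis using True by (simp add: isCont_def)
    qed
  qed
  then have \<phi>: "\<phi> holomorphic_on ?D"
    using no_isolated_singularity hol open_ball by blast
  have "((\<lambda>u. \<phi> u / (u - a)) has_contour_integral 2 * of_real pi * \<i> * \<phi> a) (circlepath 0 r)"
  proof (rule Cauchy_integral_circlepath)
    have "cball 0 r \<subseteq> ?D" using r by auto
    then show "continuous_on (cball 0 r) \<phi>" "\<phi> holomorphic_on ball 0 r"
      using \<phi> holomorphic_on_subset holomorphic_on_imp_continuous_on ball_subset_cball by blast+
  qed (use a in simp)
  then have "((\<lambda>u. \<phi> u / (u - a)) has_contour_integral 2 * of_real pi * \<i> * f (g a)) (circlepath 0 r)"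
    by (simp add: \<phi>_def)
  then show ?thesis
  proof (rule has_contour_integral_eq)
    fix u assume "u \<in> path_image (circlepath 0 r)"
    moreover have "r > 0" using a norm_ge_zero[of a] by linarith
    ultimately have "norm u = r" by (simp add: path_image_circlepath)
    then have "u - a \<noteq> 0" using a by auto
    then show "\<phi> u / (u - a) = f (g u) * deriv g u / (g u - g a)"
      by (simp add: \<phi>_def)
  qed
qed

lemma Runge_simply_connected_proper:
  assumes \<Omega>: "open \<Omega>" "simply_connected \<Omega>" "\<Omega> \<noteq> UNIV"
    and f: "f holomorphic_on \<Omega>" and K: "compact K" "K \<subseteq> \<Omega>"
  shows "poly_approximable K f"
proof (cases "K = {}")
  case True
  then show ?thesis by (simp add: poly_approximable_def)
next
  case False
  let ?D = "ball (0::complex) 1"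
  have "\<Omega> \<noteq> {}" using False K by auto
  then obtain h g where h: "h holomorphic_on \<Omega>" and g: "g holomorphic_on ?D"
    and hg: "\<And>z. z \<in> \<Omega> \<Longrightarrow> h z \<in> ?D \<and> g (h z) = z" and gh: "\<And>z. z \<in> ?D \<Longrightarrow> g z \<in> \<Omega> \<and> h (g z) = z"
    using simply_connected_eq_biholomorphic_to_disc[OF \<Omega>(1)] \<Omega>(2,3) by blast
  have inj: "inj_on g ?D" using gh by (metis inj_onI)
  have img: "g ` ?D \<subseteq> \<Omega>" using gh by blast
  have conth: "continuous_on K (\<lambda>z. norm (h z))"
    using holomorphic_on_imp_continuous_on[OF holomorphic_on_subset[OF h K(2)]]
    by (intro continuous_intros)
  obtain z0 where z0: "z0 \<in> K" "\<forall>z\<in>K. norm (h z) \<le> norm (h z0)"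
    using continuous_attains_sup[OF K(1) False conth] by blast
  \<comment> \<open>The maximum of \<open>norm (h z)\<close> over \<open>K\<close> is attained and
    hence less than 1. The closed disc of radius \<open>r\<close> then has an image that contains
    \<open>K\<close>.\<close>
  define r where "r = norm (h z0)"
  \<comment> \<open>The contour below has a radius \<open>s\<close> strictly between
    \<open>r\<close> and 1: its image stays in \<open>\<Omega>\<close> and, by injectivity of
    \<open>g\<close>, misses \<open>L\<close>.\<close>
  have r: "0 \<le> r" "r < 1" using hg[of z0] z0 K by (auto simp: r_def)
  define s where "s = (r + 1) / 2"
  have s: "r < s" "s < 1" "0 < s" using r by (auto simp: s_def)
  define L where "L = g ` cball 0 r"
  have rD: "cball 0 r \<subseteq> ?D" using r by auto
  have KL: "K \<subseteq> L"
  proof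
    fix z assume z: "z \<in> K"
    then have "z = g (h z)" "h z \<in> cball 0 r" using hg K z0 by (auto simp: r_def)
    then show "z \<in> L" unfolding L_def by blast
  qed
  have contg: "continuous_on ?D g" using g holomorphic_on_imp_continuous_on by blast
  have contL: "continuous_on (cball 0 r) g" using contg rD continuous_on_subset by blast
  have L: "compact L" unfolding L_def by (intro compact_continuous_image contL compact_cball)
  \<comment> \<open>\<open>K\<close> itself may have a disconnected complement. \<open>L\<close> is
    homeomorphic to a convex compact set, so its complement is connected.\<close>
  have "cball (0::complex) r homeomorphic L"
    using homeomorphic_compact[OF compact_cball contL L_def[symmetric] inj_on_subset[OF inj rD]] .
  then have "L homeomorphic cball (0::complex) r"
    by (rule homeomorphic_sym[THEN iffD1])
  then have conL: "connected (- L)"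
    using connected_complement_homeomorphic_convex_compact[of L "cball (0::complex) r"] by simp
  define u where "u = circlepath 0 s"
  have nu: "norm (u t) = s" for t
    using s by (simp add: u_def circlepath norm_mult)
  have uD: "u t \<in> ?D" for t using nu s by simp
  have contu: "continuous_on A u" for A
    unfolding u_def circlepath by (intro continuous_intros)
  have guL: "g (u t) \<notin> L" for t
  proof
    assume "g (u t) \<in> L"
    then obtain v where "v \<in> cball 0 r" "g v = g (u t)" unfolding L_def by auto
    then have "v = u t" using inj uD rD by (auto dest!: inj_onD)
    then show False using nu[of t] s \<open>v \<in> cball 0 r\<close> by simp
  qed
  \<comment> \<open>The numerator of Cauchy's integrand times the derivative of the circle path,
    divided by \<open>2 * pi * \<i>\<close>. The minus sign in front of \<open>c\<close> below comes
    from writing the kernel with \<open>z - g (u t)\<close> instead of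
    \<open>g (u t) - z\<close>.\<close>
  define c where "c = (\<lambda>t. f (g (u t)) * deriv g (u t) * exp (2 * of_real pi * \<i> * of_real t) * of_real s)"
  have fg: "(\<lambda>u. f (g u)) holomorphic_on ?D"
    using holomorphic_on_compose[OF g holomorphic_on_subset[OF f img]] by (simp add: o_def)
  have dg: "deriv g holomorphic_on ?D"
    by (intro holomorphic_deriv g open_ball)
  have contgu: "continuous_on {0..1} (\<lambda>t. g (u t))"
    by (rule continuous_on_compose2[OF contg contu]) (use uD in auto)
  have contc: "continuous_on {0..1} c"
    unfolding c_def
    using uD
    by (intro continuous_on_mult continuous_intros
      continuous_on_compose2[OF holomorphic_on_imp_continuous_on[OF fg] contu]
      continuous_on_compose2[OF holomorphic_on_imp_continuous_on[OF dg] contu]) auto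
  have "poly_approximable L f"
  proof (rule poly_approximable_integral[where F = "\<lambda>t z. - c t * (1 / (z - g (u t)))", OF L])
    have "continuous_on ({0..1} \<times> L) (\<lambda>x. - c (fst x) * (1 / (snd x - g (u (fst x)))))"
      using guL
      by (intro continuous_intros continuous_on_compose2[OF contc] continuous_on_compose2[OF contgu]) auto
    then show "continuous_on ({0..1} \<times> L) (\<lambda>(t, z). - c t * (1 / (z - g (u t))))"
      by (simp add: case_prod_unfold)
  next
    fix t :: real
    show "poly_approximable L (\<lambda>z. - c t * (1 / (z - g (u t))))"
      by (intro poly_approximable_mult poly_approximable_const poly_approximable_pole L conL guL)
  next
    fix z assume "z \<in> L"
    then obtain a where a: "z = g a" "norm a \<le> r" by (auto simp: L_def)
    have "((\<lambda>u. f (g u) * deriv g u / (g u - z)) has_contour_integral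
        2 * of_real pi * \<i> * f z) u"
      unfolding u_def a(1) using a s
      by (intro Cauchy_integral_image_circle g inj holomorphic_on_subset[OF f img]) auto
    then have "((\<lambda>t. f (g (u t)) * deriv g (u t) / (g (u t) - z) *
        (2 * pi * \<i> * s * exp (2 * of_real pi * \<i> * t))) has_integral 2 * of_real pi * \<i> * f z) {0..1}"
      unfolding has_contour_integral_def
      by (rule has_integral_eq[rotated]) (simp add: u_def vector_derivative_circlepath01)
    then have "((\<lambda>t. (f (g (u t)) * deriv g (u t) / (g (u t) - z) *
        (2 * pi * \<i> * s * exp (2 * of_real pi * \<i> * t))) * (1 / (2 * of_real pi * \<i>)))
        has_integral (2 * of_real pi * \<i> * f z) * (1 / (2 * of_real pi * \<i>))) {0..1}"
      by (rule has_integral_mult_left)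
    then have "((\<lambda>t. (f (g (u t)) * deriv g (u t) / (g (u t) - z) *
        (2 * pi * \<i> * s * exp (2 * of_real pi * \<i> * t))) * (1 / (2 * of_real pi * \<i>)))
        has_integral f z) {0..1}"
      by simp
    then show "((\<lambda>t. - c t * (1 / (z - g (u t)))) has_integral f z) {0..1}"
    proof (rule has_integral_eq[rotated])
      fix t :: real
      have "g (u t) - z \<noteq> 0" "z - g (u t) \<noteq> 0" using guL[of t] \<open>z \<in> L\<close> by auto
      then show "(f (g (u t)) * deriv g (u t) / (g (u t) - z) *
        (2 * pi * \<i> * s * exp (2 * of_real pi * \<i> * t))) * (1 / (2 * of_real pi * \<i>)) =
        - c t * (1 / (z - g (u t)))"
        by (simp add: c_def divide_simps) (simp add: algebra_simps)
    qed
  qed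
  then show ?thesis using KL by (rule poly_approximable_subset)
qed

text \<open>The whole plane has no Riemann map onto the disc; there a ball containing
  \<open>K\<close> serves as the domain.\<close>

theorem Runge_simply_connected:
  assumes \<Omega>: "open \<Omega>" "simply_connected \<Omega>"
    and f: "f holomorphic_on \<Omega>" and K: "compact K" "K \<subseteq> \<Omega>"
  shows "poly_approximable K f"
proof (cases "\<Omega> = UNIV")
  case False
  then show ?thesis using Runge_simply_connected_proper assms by blast
next
  case True
  obtain R where "K \<subseteq> ball 0 R"
    using bounded_subset_ballD[OF compact_imp_bounded[OF K(1)]] by blast
  moreover have "ball (0::complex) R \<noteq> UNIV"
    using bounded_ball not_bounded_UNIV by metis
  ultimately show ?thesis
    using holomorphic_on_subset[OF f, of "ball 0 R"] True K(1)
    by (intro Runge_simply_connected_proper[of "ball 0 R"] convex_imp_simply_connected) auto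
qed

section \<open>The space of holomorphic functions and the operators\<close>

text \<open>The sets \<open>hol_nbhd \<Omega> f K e\<close> are open, and every nonempty open set
  contains one with \<open>e > 0\<close>, so density can be tested on them.\<close>

lemma dense_in_hol_iff:
  "hol_topology \<Omega> closure_of A = hol \<Omega> \<longleftrightarrow>
    (\<forall>f\<in>hol \<Omega>. \<forall>K e. compact K \<longrightarrow> K \<subseteq> \<Omega> \<longrightarrow> e > 0 \<longrightarrow> A \<inter> hol_nbhd \<Omega> f K e \<noteq> {})"
proof -
  have "(\<forall>U. openin (hol_topology \<Omega>) U \<and> U \<noteq> {} \<longrightarrow> A \<inter> U \<noteq> {}) \<longleftrightarrow>
    (\<forall>f\<in>hol \<Omega>. \<forall>K e. compact K \<longrightarrow> K \<subseteq> \<Omega> \<longrightarrow> e > 0 \<longrightarrow> A \<inter> hol_nbhd \<Omega> f K e \<noteq> {})"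
  proof (intro iffI ballI allI impI)
    fix f K and e :: real
    assume *: "\<forall>U. openin (hol_topology \<Omega>) U \<and> U \<noteq> {} \<longrightarrow> A \<inter> U \<noteq> {}"
      and "f \<in> hol \<Omega>" "compact K" "K \<subseteq> \<Omega>" "e > 0"
    then have "openin (hol_topology \<Omega>) (hol_nbhd \<Omega> f K e)" "f \<in> hol_nbhd \<Omega> f K e"
      by (simp_all add: openin_hol_nbhd) (simp add: hol_nbhd_def)
    then show "A \<inter> hol_nbhd \<Omega> f K e \<noteq> {}" using * by blast
  next
    fix U
    assume *: "\<forall>f\<in>hol \<Omega>. \<forall>K e. compact K \<longrightarrow> K \<subseteq> \<Omega> \<longrightarrow> e > 0 \<longrightarrow> A \<inter> hol_nbhd \<Omega> f K e \<noteq> {}"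
      and U: "openin (hol_topology \<Omega>) U \<and> U \<noteq> {}"
    then obtain f where f: "f \<in> U" "f \<in> hol \<Omega>" unfolding openin_hol_topology by blast
    then obtain K e where "compact K" "K \<subseteq> \<Omega>" "e > 0" "hol_nbhd \<Omega> f K e \<subseteq> U"
      using U unfolding openin_hol_topology by blast
    then show "A \<inter> U \<noteq> {}" using * f(2) by blast
  qed
  then show ?thesis
    using dense_intersects_open[of "hol_topology \<Omega>" A] by simp
qed

lemma S_class_iff:
  assumes "open \<Omega>"
  shows "f \<in> S_class \<Omega> \<longleftrightarrow> f \<in> hol \<Omega> \<and>
    (\<forall>h\<in>hol \<Omega>. \<forall>K e. compact K \<longrightarrow> K \<subseteq> \<Omega> \<longrightarrow> e > 0 \<longrightarrow> (\<exists>N. T_tilde \<Omega> N f \<in> hol_nbhd \<Omega> h K e))"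
  using dense_in_hol_iff[of \<Omega> "range (\<lambda>N. T_tilde \<Omega> N f)"]
  by (auto simp: S_class_def Int_def) 

text \<open>Derivatives at a point of an open set depend only on nearby values, so they survive the
  passage to the representative that is \<open>undefined\<close> outside
  \<open>\<Omega>\<close>.\<close>

lemma higher_deriv_restrict:
  assumes "open \<Omega>" "f holomorphic_on \<Omega>" "z \<in> \<Omega>"
  shows "(deriv ^^ n) (restrict f \<Omega>) z = (deriv ^^ n) f z"
  by (rule higher_deriv_transform_within_open[OF _ assms(2,1,3)])
    (use assms in \<open>auto intro: holomorphic_transform\<close>)

lemma restrict_in_hol: "f holomorphic_on \<Omega> \<Longrightarrow> restrict f \<Omega> \<in> hol \<Omega>"
  by (auto simp: hol_def intro: holomorphic_transform)

section \<open>Continuity of the operators\<close>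

text \<open>Cauchy's inequality on the circle of radius \<open>r\<close> bounds the
  \<open>n\<close>-th Taylor coefficient of \<open>f - g\<close> at \<open>\<zeta>\<close> by
  \<open>B / r ^ n\<close>.\<close>

lemma dist_T_tilde_le:
  assumes \<Omega>: "open \<Omega>" and f: "f \<in> hol \<Omega>" and g: "g \<in> hol \<Omega>"
    and r: "r > 0" "cball \<zeta> r \<subseteq> \<Omega>"
    and B: "\<And>w. w \<in> cball \<zeta> r \<Longrightarrow> dist (f w) (g w) \<le> B"
  shows "dist (T_tilde \<Omega> N f \<zeta>) (T_tilde \<Omega> N g \<zeta>) \<le> B * (\<Sum>n\<le>N. (norm \<zeta> / r) ^ n)"
proof -
  have \<zeta>: "\<zeta> \<in> \<Omega>" using r by auto
  have hol: "f holomorphic_on \<Omega>" "g holomorphic_on \<Omega>" using f g by (auto simp: hol_def)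
  then have d: "(\<lambda>w. f w - g w) holomorphic_on \<Omega>" by (intro holomorphic_intros)
  have "T_tilde \<Omega> N f \<zeta> - T_tilde \<Omega> N g \<zeta> =
    (\<Sum>n\<le>N. (deriv ^^ n) (\<lambda>w. f w - g w) \<zeta> / fact n * (- \<zeta>) ^ n)"
    using \<zeta> by (simp add: T_tilde_def higher_deriv_diff[OF hol \<Omega> \<zeta>] diff_divide_distrib
        left_diff_distrib sum_subtractf)
  also have "norm \<dots> \<le> (\<Sum>n\<le>N. B * (norm \<zeta> / r) ^ n)"
  proof (rule sum_norm_le)
    fix n
    have "norm ((deriv ^^ n) (\<lambda>w. f w - g w) \<zeta>) \<le> fact n * B / r ^ n"
    proof (rule Cauchy_inequality)
      show "(\<lambda>w. f w - g w) holomorphic_on ball \<zeta> r"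
        using d r(2) ball_subset_cball holomorphic_on_subset by blast
      show "continuous_on (cball \<zeta> r) (\<lambda>w. f w - g w)"
        using d r(2) holomorphic_on_subset holomorphic_on_imp_continuous_on by blast
      show "norm (f w - g w) \<le> B" if "norm (\<zeta> - w) = r" for w
        using B[of w] that by (simp add: dist_norm)
    qed (use r in simp)
    then have "norm ((deriv ^^ n) (\<lambda>w. f w - g w) \<zeta>) / fact n \<le> B / r ^ n"
      by (simp add: field_simps)
    then have "norm ((deriv ^^ n) (\<lambda>w. f w - g w) \<zeta>) / fact n * norm \<zeta> ^ n \<le> B / r ^ n * norm \<zeta> ^ n"
      by (rule mult_right_mono) simp
    then show "norm ((deriv ^^ n) (\<lambda>w. f w - g w) \<zeta> / fact n * (- \<zeta>) ^ n) \<le> B * (norm \<zeta> / r) ^ n"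
      by (simp add: norm_mult norm_divide norm_power power_divide)
  qed
  finally show ?thesis by (simp add: dist_norm sum_distrib_left)
qed

lemma T_tilde_nbhd:
  assumes \<Omega>: "open \<Omega>" and f: "f \<in> hol \<Omega>" and K: "compact K" "K \<subseteq> \<Omega>" and e: "e > 0"
  obtains L d where "compact L" "L \<subseteq> \<Omega>" "d > 0"
    "\<And>g. g \<in> hol_nbhd \<Omega> f L d \<Longrightarrow> T_tilde \<Omega> N g \<in> hol_nbhd \<Omega> (T_tilde \<Omega> N f) K e"
proof (cases "K = {}")
  \<comment> \<open>By convention \<open>infdist\<close> to the empty set is 0, which would make the
    set \<open>L\<close> of the other case the whole plane.\<close>
  case True
  then show thesis
    using that[of "{}" 1] T_tilde_in_hol[OF \<Omega>] by (auto simp: hol_nbhd_def)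
next
  case False
  obtain r where r: "r > 0" "(\<Union>x\<in>K. cball x r) \<subseteq> \<Omega>"
    using compact_subset_open_imp_cball_epsilon_subset[OF K(1) \<Omega> K(2)] by blast
  \<comment> \<open>The closed \<open>r\<close>-neighbourhood of \<open>K\<close>: compact, inside
    \<open>\<Omega>\<close>, and containing every disc on which Cauchy's inequality is used.\<close>
  define L where "L = {x. infdist x K \<le> r}"
  have L: "compact L" unfolding L_def using compact_infdist_le[OF False K(1) r(1)] .
  have "L \<subseteq> (\<Union>x\<in>K. cball x r)"
  proof
    fix x assume x: "x \<in> L"
    obtain y where "y \<in> K" "infdist x K = dist x y"
      using infdist_attains_inf[OF compact_imp_closed[OF K(1)] False] by blast
    then show "x \<in> (\<Union>x\<in>K. cball x r)" using x by (auto simp: L_def dist_commute)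
  qed
  then have L\<Omega>: "L \<subseteq> \<Omega>" using r by blast
  have cballL: "cball x r \<subseteq> L" if "x \<in> K" for x
    using that by (auto simp: L_def dist_commute intro: order_trans[OF infdist_le])
  obtain R where R: "R > 0" "\<And>z. z \<in> K \<Longrightarrow> norm z \<le> R"
    using compact_imp_bounded[OF K(1)] bounded_pos by blast
  define C where "C = (\<Sum>n\<le>N. (R / r) ^ n)"
  have C: "C > 0" unfolding C_def using R r by (intro sum_pos) auto
  \<comment> \<open>\<open>C\<close> bounds the sum in \<open>dist_T_tilde_le\<close> on all of
    \<open>K\<close>; the factor 2 makes the final inequality strict.\<close>
  define d where "d = e / (2 * C)"
  have d: "d > 0" using C e by (simp add: d_def)
  show thesis
  proof (rule that[OF L L\<Omega> d])
    fix g assume g: "g \<in> hol_nbhd \<Omega> f L d"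
    then have gh: "g \<in> hol \<Omega>" by (simp add: hol_nbhd_def)
    have "dist (T_tilde \<Omega> N g z) (T_tilde \<Omega> N f z) < e" if "z \<in> K" for z
    proof -
      have "dist (T_tilde \<Omega> N g z) (T_tilde \<Omega> N f z) \<le> d * (\<Sum>n\<le>N. (norm z / r) ^ n)"
        using g cballL[OF that] L\<Omega>
        by (intro dist_T_tilde_le \<Omega> gh f r(1)) (auto simp: hol_nbhd_def less_imp_le)
      also have "\<dots> \<le> d * C"
        unfolding C_def using R(2)[OF that] r(1) d
        by (intro mult_left_mono sum_mono power_mono divide_right_mono) auto
      also have "\<dots> < e" using C e by (simp add: d_def)
      finally show ?thesis .
    qed
    then show "T_tilde \<Omega> N g \<in> hol_nbhd \<Omega> (T_tilde \<Omega> N f) K e"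
      using T_tilde_in_hol[OF \<Omega> gh] by (simp add: hol_nbhd_def)
  qed
qed

lemma continuous_map_T_tilde:
  assumes \<Omega>: "open \<Omega>"
  shows "continuous_map (hol_topology \<Omega>) (hol_topology \<Omega>) (T_tilde \<Omega> N)"
  unfolding continuous_map_def
proof (intro conjI allI impI)
  show "T_tilde \<Omega> N \<in> topspace (hol_topology \<Omega>) \<rightarrow> topspace (hol_topology \<Omega>)"
    using T_tilde_in_hol[OF \<Omega>] by auto
  fix U assume U: "openin (hol_topology \<Omega>) U"
  show "openin (hol_topology \<Omega>) {f \<in> topspace (hol_topology \<Omega>). T_tilde \<Omega> N f \<in> U}"
    unfolding openin_hol_topology
  proof (intro conjI ballI)
    fix f assume "f \<in> {f \<in> topspace (hol_topology \<Omega>). T_tilde \<Omega> N f \<in> U}"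
    then have f: "f \<in> hol \<Omega>" "T_tilde \<Omega> N f \<in> U" by auto
    then obtain K e where K: "compact K" "K \<subseteq> \<Omega>" "e > 0" "hol_nbhd \<Omega> (T_tilde \<Omega> N f) K e \<subseteq> U"
      using U unfolding openin_hol_topology by blast
    obtain L d where "compact L" "L \<subseteq> \<Omega>" "d > 0"
      "\<And>g. g \<in> hol_nbhd \<Omega> f L d \<Longrightarrow> T_tilde \<Omega> N g \<in> hol_nbhd \<Omega> (T_tilde \<Omega> N f) K e"
      using T_tilde_nbhd[OF \<Omega> f(1) K(1-3)] by blast
    then show "\<exists>L d. compact L \<and> L \<subseteq> \<Omega> \<and> d > 0 \<and>
        hol_nbhd \<Omega> f L d \<subseteq> {f \<in> topspace (hol_topology \<Omega>). T_tilde \<Omega> N f \<in> U}"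
      using K(4) by (intro exI[of _ L] exI[of _ d]) (auto simp: hol_nbhd_def)
  qed simp
qed

section \<open>Perturbation by polynomials\<close>

lemma higher_deriv_poly: "(deriv ^^ n) (poly p) = poly ((pderiv ^^ n) p)" for p :: "complex poly"
proof (induction n)
  case (Suc n)
  have "deriv (poly q) = poly (pderiv q)" for q :: "complex poly"
    by (rule ext) (rule DERIV_imp_deriv[OF poly_DERIV])
  then show ?case by (simp add: Suc.IH)
qed simp

lemma higher_pderiv_eq_0: "degree p < n \<Longrightarrow> (pderiv ^^ n) p = 0" for p :: "complex poly"
proof (induction n arbitrary: p)
  case (Suc n)
  have 0: "(pderiv ^^ n) 0 = (0 :: complex poly)" by (induction n) auto
  show ?case
  proof (cases "degree p = 0")
    case True
    then have "pderiv p = 0" by (simp add: pderiv_eq_0_iff)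
    then show ?thesis using 0 by (simp add: funpow_Suc_right del: funpow.simps)
  next
    case False
    then have "degree (pderiv p) < n" using Suc.prems by (simp add: degree_pderiv)
    then show ?thesis using Suc.IH by (simp add: funpow_Suc_right del: funpow.simps)
  qed
qed simp

text \<open>This is the Taylor expansion of \<open>p\<close> about \<open>\<zeta>\<close>, evaluated
  at 0; all derivatives beyond the degree vanish.\<close>

lemma sum_higher_deriv_poly:
  fixes p :: "complex poly"
  assumes "degree p \<le> N"
  shows "(\<Sum>n\<le>N. (deriv ^^ n) (poly p) \<zeta> / fact n * (- \<zeta>) ^ n) = poly p 0"
proof -
  let ?t = "\<lambda>n. (deriv ^^ n) (poly p) \<zeta> / fact n * (- \<zeta>) ^ n"
  have "(\<lambda>n. (deriv ^^ n) (poly p) \<zeta> / fact n * (0 - \<zeta>) ^ n) sums poly p 0"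
    using holomorphic_power_series[of "poly p" \<zeta> "norm \<zeta> + 1" 0]
      poly_holomorphic_on[OF holomorphic_on_ident] by (simp add: dist_norm dist_commute)
  moreover have "?t sums (\<Sum>n\<le>N. ?t n)"
    by (rule sums_finite) (use assms in \<open>auto simp: higher_deriv_poly higher_pderiv_eq_0\<close>)
  ultimately show ?thesis by (simp add: sums_unique2)
qed

lemma T_tilde_add_poly:
  assumes \<Omega>: "open \<Omega>" and f: "f \<in> hol \<Omega>" and N: "degree p \<le> N" and \<zeta>: "\<zeta> \<in> \<Omega>"
  shows "T_tilde \<Omega> N (\<lambda>z\<in>\<Omega>. f z + poly p z) \<zeta> = T_tilde \<Omega> N f \<zeta> + poly p 0"
proof -
  have hol: "f holomorphic_on \<Omega>" "poly p holomorphic_on \<Omega>"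
    using f by (auto simp: hol_def intro!: holomorphic_intros)
  have "(deriv ^^ n) (\<lambda>z\<in>\<Omega>. f z + poly p z) \<zeta> = (deriv ^^ n) f \<zeta> + (deriv ^^ n) (poly p) \<zeta>" for n
    using higher_deriv_restrict[OF \<Omega> holomorphic_on_add[OF hol] \<zeta>, of n]
      higher_deriv_add[OF hol \<Omega> \<zeta>, of n] by simp
  then show ?thesis
    using \<zeta> sum_higher_deriv_poly[OF N, of \<zeta>]
    by (simp add: T_tilde_def add_divide_distrib distrib_right sum.distrib)
qed

text \<open>A small constant \<open>c\<close> is added to \<open>h\<close> so that, at one point
  \<open>z0\<close>, the new target keeps away from the finitely many values taken by the operators
  of index below \<open>M\<close>. A close enough approximation then has a late index.\<close>

lemma S_class_arbitrarily_late:
  assumes \<Omega>: "open \<Omega>" "\<Omega> \<noteq> {}" and f: "f \<in> S_class \<Omega>" and h: "h \<in> hol \<Omega>"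
    and K: "compact K" "K \<subseteq> \<Omega>" and e: "e > 0"
  obtains N where "N \<ge> M" "T_tilde \<Omega> N f \<in> hol_nbhd \<Omega> h K e"
proof -
  obtain z0 where z0: "z0 \<in> \<Omega>" using \<Omega> by blast
  define F where "F = (\<lambda>N. T_tilde \<Omega> N f z0) ` {..<M}"
  have "open (ball (h z0) (e / 2) - F)"
    by (intro open_Diff finite_imp_closed) (auto simp: F_def)
  moreover have "ball (h z0) (e / 2) - F \<noteq> {}"
  proof
    assume "ball (h z0) (e / 2) - F = {}"
    then have "finite (ball (h z0) (e / 2))"
      using finite_subset[of "ball (h z0) (e / 2)" F] by (auto simp: F_def)
    then show False using e finite_imp_not_open[OF _ open_ball] by fastforce
  qed
  ultimately obtain b d' where b: "d' > 0" "ball b d' \<subseteq> ball (h z0) (e / 2) - F"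
    unfolding open_contains_ball by blast
  define c where "c = b - h z0"
  \<comment> \<open>\<open>d'\<close> excludes the early indices at \<open>z0\<close>;
    \<open>e / 2\<close> leaves room for the shift by \<open>c\<close>.\<close>
  define d where "d = min d' (e / 2)"
  have d: "d > 0" using b e by (simp add: d_def)
  have "b \<in> ball (h z0) (e / 2)" using b centre_in_ball[of b d'] by blast
  then have c: "norm c < e / 2" by (simp add: c_def dist_norm norm_minus_commute)
  have "(\<lambda>z\<in>\<Omega>. h z + c) \<in> hol \<Omega>"
    using h by (intro restrict_in_hol holomorphic_intros) (simp add: hol_def)
  \<comment> \<open>The point \<open>z0\<close> is inserted because it need not lie in
    \<open>K\<close>, yet the approximation must hold there.\<close>
  then obtain N where N: "T_tilde \<Omega> N f \<in> hol_nbhd \<Omega> (\<lambda>z\<in>\<Omega>. h z + c) (insert z0 K) d"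
    using f K(2) z0 d compact_insert[OF K(1), of z0] unfolding S_class_iff[OF \<Omega>(1)]
    by (meson insert_subsetI)
  show thesis
  proof (rule that)
    show "N \<ge> M"
    proof (rule ccontr)
      assume "\<not> N \<ge> M"
      then have "T_tilde \<Omega> N f z0 \<in> F" by (auto simp: F_def)
      moreover have "dist b (T_tilde \<Omega> N f z0) < d'"
        using N z0 by (simp add: hol_nbhd_def c_def d_def dist_commute)
      ultimately show False using b(2) by auto
    qed
    have "dist (T_tilde \<Omega> N f z) (h z) < e" if "z \<in> K" for z
    proof -
      have "dist (T_tilde \<Omega> N f z) (h z + c) < e / 2"
        using N bspec[of K _ z] that subsetD[OF K(2) that] by (fastforce simp: hol_nbhd_def d_def)
      moreover have "dist (h z + c) (h z) < e / 2" using c by (simp add: dist_norm)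
      ultimately show ?thesis
        using dist_triangle[of "T_tilde \<Omega> N f z" "h z" "h z + c"] by linarith
    qed
    then show "T_tilde \<Omega> N f \<in> hol_nbhd \<Omega> h K e"
      using N by (simp add: hol_nbhd_def)
  qed
qed

text \<open>To reach \<open>h\<close>, the function \<open>h - poly p 0\<close> is approximated by
  \<open>T_tilde \<Omega> N f\<close> with \<open>N\<close> at least the degree of \<open>p\<close>;
  adding \<open>p\<close> then restores exactly the missing constant.\<close>

lemma S_class_add_poly:
  assumes \<Omega>: "open \<Omega>" "\<Omega> \<noteq> {}" and f: "f \<in> S_class \<Omega>"
  shows "(\<lambda>z\<in>\<Omega>. f z + poly p z) \<in> S_class \<Omega>"
  unfolding S_class_iff[OF \<Omega>(1)]
proof (intro conjI ballI allI impI)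
  have fh: "f \<in> hol \<Omega>" using f by (simp add: S_class_def)
  show g: "(\<lambda>z\<in>\<Omega>. f z + poly p z) \<in> hol \<Omega>"
    using fh by (intro restrict_in_hol holomorphic_intros) (auto simp: hol_def)
  fix h K and e :: real
  assume h: "h \<in> hol \<Omega>" and K: "compact K" "K \<subseteq> \<Omega>" and e: "e > 0"
  have "(\<lambda>z\<in>\<Omega>. h z - poly p 0) \<in> hol \<Omega>"
    using h by (intro restrict_in_hol holomorphic_intros) (simp add: hol_def)
  then obtain N where N: "degree p \<le> N" "T_tilde \<Omega> N f \<in> hol_nbhd \<Omega> (\<lambda>z\<in>\<Omega>. h z - poly p 0) K e"
    using S_class_arbitrarily_late[OF \<Omega> f _ K e] by blast
  have "dist (T_tilde \<Omega> N (\<lambda>z\<in>\<Omega>. f z + poly p z) z) (h z) < e" if "z \<in> K" for z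
  proof -
    have z: "z \<in> \<Omega>" using that K(2) by blast
    then have "dist (T_tilde \<Omega> N f z) (h z - poly p 0) < e"
      using N(2) that by (auto simp: hol_nbhd_def)
    then show ?thesis
      using T_tilde_add_poly[OF \<Omega>(1) fh N(1) z] by (simp add: dist_norm algebra_simps)
  qed
  then show "\<exists>N. T_tilde \<Omega> N (\<lambda>z\<in>\<Omega>. f z + poly p z) \<in> hol_nbhd \<Omega> h K e"
    using T_tilde_in_hol[OF \<Omega>(1) g] by (auto simp: hol_nbhd_def)
qed

section \<open>The countable intersection and the density\<close>

lemma gdelta_in_S_class:
  assumes \<Omega>: "open \<Omega>" and f0: "f0 \<in> S_class \<Omega>"
  shows "gdelta_in (hol_topology \<Omega>) (S_class \<Omega>)"
proof -
  obtain C where C: "\<And>n. compact (C n)" "\<And>n. C n \<subseteq> \<Omega>" "\<And>n. C n \<subseteq> interior (C (Suc n))"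
    "\<Union>(range C) = \<Omega>" "\<And>K. compact K \<Longrightarrow> K \<subseteq> \<Omega> \<Longrightarrow> \<exists>N. \<forall>n\<ge>N. K \<subseteq> C n"
  proof (rule open_Union_compact_subsets[OF \<Omega>], goal_cases)
    case (1 C)
    show thesis by (rule 1(1)[of C, OF 1(2-6)])
  qed
  have f0h: "T_tilde \<Omega> N f0 \<in> hol \<Omega>" for N
    using f0 T_tilde_in_hol[OF \<Omega>] by (simp add: S_class_def)
  \<comment> \<open>Countably many neighbourhoods suffice: centres from the dense sequence given by
    \<open>f0\<close>, compact sets from an exhaustion, radii \<open>1 / Suc m\<close>.
    \<open>G i\<close> collects the functions that some operator sends into
    \<open>B i\<close>.\<close>
  define B where "B = (\<lambda>(k, n, m). hol_nbhd \<Omega> (T_tilde \<Omega> k f0) (C n) (1 / real (Suc m)))"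
  define G where "G = (\<lambda>i. \<Union>N. {f \<in> hol \<Omega>. T_tilde \<Omega> N f \<in> B i})"
  have openB: "openin (hol_topology \<Omega>) (B i)" for i
    using openin_hol_nbhd[OF C(1,2) f0h] by (auto simp: B_def split: prod.splits)
  have openG: "openin (hol_topology \<Omega>) (G i)" for i
    unfolding G_def
    using openin_continuous_map_preimage[OF continuous_map_T_tilde[OF \<Omega>] openB[of i]]
    by (intro openin_Union) auto
  have "S_class \<Omega> = (\<Inter>i. G i)"
  proof (intro equalityI subsetI)
    fix f assume f: "f \<in> S_class \<Omega>"
    have "f \<in> G (k, n, m)" for k n m
    proof -
      have "\<exists>N. T_tilde \<Omega> N f \<in> hol_nbhd \<Omega> (T_tilde \<Omega> k f0) (C n) (1 / real (Suc m))"
        using f f0h C unfolding S_class_iff[OF \<Omega>] by simp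
      then show ?thesis using f by (auto simp: G_def B_def S_class_def)
    qed
    then show "f \<in> (\<Inter>i. G i)" by auto
  next
    fix f assume f: "f \<in> (\<Inter>i. G i)"
    then have fh: "f \<in> hol \<Omega>" by (auto simp: G_def)
    have "\<exists>N. T_tilde \<Omega> N f \<in> hol_nbhd \<Omega> h K e"
      if h: "h \<in> hol \<Omega>" and K: "compact K" "K \<subseteq> \<Omega>" and e: "e > 0" for h K and e :: real
    proof -
      \<comment> \<open>A given neighbourhood of \<open>h\<close> is reached through a centre within
        \<open>e / 2\<close> of \<open>h\<close> on \<open>K\<close> and a radius below
        \<open>e / 2\<close>.\<close>
      obtain n where n: "K \<subseteq> C n" using C(5)[OF K] by blast
      obtain m where m: "1 / real (Suc m) < e / 2" using e nat_approx_posE[of "e / 2"] by auto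
      obtain k where k: "T_tilde \<Omega> k f0 \<in> hol_nbhd \<Omega> h K (e / 2)"
        using f0 h K e unfolding S_class_iff[OF \<Omega>] by (metis half_gt_zero)
      have "f \<in> G (k, n, m)" using f by blast
      then obtain N where N: "T_tilde \<Omega> N f \<in> hol_nbhd \<Omega> (T_tilde \<Omega> k f0) (C n) (1 / real (Suc m))"
        by (auto simp: G_def B_def)
      have "dist (T_tilde \<Omega> N f z) (h z) < e" if "z \<in> K" for z
      proof -
        have "dist (T_tilde \<Omega> N f z) (T_tilde \<Omega> k f0 z) < 1 / real (Suc m)"
          "dist (T_tilde \<Omega> k f0 z) (h z) < e / 2"
          using N k n that unfolding hol_nbhd_def by blast+
        then show ?thesis
          using m dist_triangle[of "T_tilde \<Omega> N f z" "h z" "T_tilde \<Omega> k f0 z"] by linarith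
      qed
      then show ?thesis using N by (auto simp: hol_nbhd_def)
    qed
    then show "f \<in> S_class \<Omega>" using fh unfolding S_class_iff[OF \<Omega>] by blast
  qed
  moreover have "gdelta_in (hol_topology \<Omega>) (\<Inter>(range G))"
    by (intro gdelta_in_Inter) (auto intro: open_imp_gdelta_in openG)
  ultimately show ?thesis by simp
qed

theorem proposition4p4:
  fixes \<Omega> :: "complex set"
  assumes "open \<Omega>" and "connected \<Omega>" and "\<Omega> \<noteq> {}" and "simply_connected \<Omega>"
  shows "S_class \<Omega> = {} \<or>
    (gdelta_in (hol_topology \<Omega>) (S_class \<Omega>) \<and>
     hol_topology \<Omega> closure_of S_class \<Omega> = topspace (hol_topology \<Omega>))"
proof (cases "S_class \<Omega> = {}")
  case False
  then obtain f0 where f0: "f0 \<in> S_class \<Omega>" by blast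
  have "S_class \<Omega> \<inter> hol_nbhd \<Omega> h K e \<noteq> {}"
    if h: "h \<in> hol \<Omega>" and K: "compact K" "K \<subseteq> \<Omega>" and e: "e > 0" for h K and e :: real
  proof -
    have "(\<lambda>z. h z - f0 z) holomorphic_on \<Omega>"
      using h f0 by (intro holomorphic_intros) (auto simp: hol_def S_class_def)
    \<comment> \<open>Runge's theorem is applied to \<open>h - f0\<close> rather than to
      \<open>h\<close>, since \<open>f0 + p\<close> is the function that stays in the class.\<close>
    then obtain p where p: "\<forall>z\<in>K. norm (h z - f0 z - poly p z) < e"
      using Runge_simply_connected[OF assms(1,4) _ K] e unfolding poly_approximable_def by blast
    define f where "f = (\<lambda>z\<in>\<Omega>. f0 z + poly p z)"
    have f: "f \<in> S_class \<Omega>"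
      unfolding f_def by (rule S_class_add_poly[OF assms(1,3) f0])
    have "dist (f z) (h z) < e" if "z \<in> K" for z
    proof -
      have "z \<in> \<Omega>" using that K(2) by blast
      then have "dist (f z) (h z) = norm (h z - f0 z - poly p z)"
        by (simp add: f_def dist_norm norm_minus_commute diff_diff_eq)
      then show ?thesis using p that by simp
    qed
    then have "f \<in> hol_nbhd \<Omega> h K e"
      using f by (simp add: hol_nbhd_def S_class_def)
    then show ?thesis using f by blast
  qed
  then show ?thesis
    using gdelta_in_S_class[OF assms(1) f0] dense_in_hol_iff[of \<Omega> "S_class \<Omega>"] by simp
qed simp

end
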